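(* Let $T$ be a finite tree. Then determining sets have the exchange property in $T$: whenever $S$ and $R$ are minimal determining sets of $T$ and $r\in R$, there exists $s\in S$ such that $(S\setminus\{s\})\cup\{r\}$ is a minimal determining set of $T$.
   Context: A set $S\subseteq V(G)$ of a graph $G$ is a determining set if whenever $g,h\in\mathrm{Aut}(G)$ satisfy $g(s)=h(s)$ for all $s\in S$, then $g=h$ (equivalently, the only automorphism fixing every vertex of $S$ is the identity). A minimal determining set is a determining set none of whose proper subsets is a determining set. *)

theory Defs
  imports "Graph_Theory.Graph_Theory" "HOL-Combinatorics.Permutations"
begin

text \<open>Following \<^locale>\<open>graph\<close>, a finite simple graph is a symmetric, loop-free digraph without
  parallel arcs. In such a digraph the closed walk \<open>u, v, u\<close> counts as a \<^const>\<open>pre_digraph.cycle\<close>,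
  so the library predicate \<^const>\<open>tree\<close> is unsuitable here: it excludes every graph that has an
  edge. The cycles of the undirected graph are the directed cycles of length at least 3.\<close>

definition finite_tree :: "('a, 'b) pre_digraph \<Rightarrow> bool" where
  "finite_tree T \<longleftrightarrow>
     graph T \<and> connected T \<and> \<not> (\<exists>p. pre_digraph.cycle T p \<and> 3 \<le> length p)"

text \<open>Automorphisms are extended by the identity outside the vertex set, so that two of them are
  equal as HOL functions iff they agree on all vertices.\<close>

definition graph_Aut :: "('a, 'b) pre_digraph \<Rightarrow> ('a \<Rightarrow> 'a) set" where
  "graph_Aut G =
     {g. g permutes verts G \<and>
         (\<forall>u \<in> verts G. \<forall>v \<in> verts G. g u \<rightarrow>\<^bsub>G\<^esub> g v \<longleftrightarrow> u \<rightarrow>\<^bsub>G\<^esub> v)}"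

definition determining_set :: "('a, 'b) pre_digraph \<Rightarrow> 'a set \<Rightarrow> bool" where
  "determining_set G S \<longleftrightarrow>
     S \<subseteq> verts G \<and>
     (\<forall>g \<in> graph_Aut G. \<forall>h \<in> graph_Aut G. (\<forall>s \<in> S. g s = h s) \<longrightarrow> g = h)"

definition minimal_determining_set :: "('a, 'b) pre_digraph \<Rightarrow> 'a set \<Rightarrow> bool" where
  "minimal_determining_set G S \<longleftrightarrow>
     determining_set G S \<and> (\<forall>S'. S' \<subset> S \<longrightarrow> \<not> determining_set G S')"

end

theory Submission
  imports Defs
begin

text \<open>
  A set is determining iff it meets every minimal support of a nontrivial automorphism. The minimal
  supports of a tree satisfy strong circuit elimination, so the minimal determining sets are the
  bases of a matroid (dual to the one whose circuits are the minimal supports), whence exchange.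

  For elimination, let \<open>U = supp g\<close> and \<open>U' = supp h\<close> be distinct minimal supports. Neither is the
  whole vertex set, so \<open>g\<close> fixes a vertex \<open>v\<close> and moves a neighbour \<open>b\<close> of \<open>v\<close>; swapping the
  branches at \<open>v\<close> through \<open>b\<close> and \<open>g b\<close> is an automorphism, so \<open>U\<close> is the union of these two
  branches. Likewise for \<open>h\<close>. Comparing cardinalities of branches shows that \<open>h\<inverse>\<close> maps any
  \<open>x \<in> U \<inter> U'\<close> out of \<open>U\<close>. Hence the support \<open>h ` U\<close> of \<open>h g h\<inverse>\<close> avoids \<open>x\<close>, contains
  \<open>U - U'\<close> and lies in \<open>U \<union> U'\<close>.
\<close>

section \<open>Exchange for minimal hitting sets\<close>

definition hitting_set :: "'a set set \<Rightarrow> 'a set \<Rightarrow> bool" where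
  "hitting_set C S \<longleftrightarrow> (\<forall>U\<in>C. S \<inter> U \<noteq> {})"

definition minimal_hitting_set :: "'a set set \<Rightarrow> 'a set \<Rightarrow> bool" where
  "minimal_hitting_set C S \<longleftrightarrow> hitting_set C S \<and> (\<forall>S'. S' \<subset> S \<longrightarrow> \<not> hitting_set C S')"

lemma hitting_set_mono: "hitting_set C S \<Longrightarrow> S \<subseteq> S' \<Longrightarrow> hitting_set C S'"
  unfolding hitting_set_def by blast

text \<open>Hitting is monotone, so minimality need only be tested by deleting one element; deleting
  \<open>s\<close> fails exactly when some member of \<open>C\<close> relies on \<open>s\<close>
  alone.\<close>

lemma minimal_hitting_set_iff:
  "minimal_hitting_set C S \<longleftrightarrow> hitting_set C S \<and> (\<forall>s\<in>S. \<exists>U\<in>C. S \<inter> U = {s})"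
proof -
  have "(\<forall>S'. S' \<subset> S \<longrightarrow> \<not> hitting_set C S') \<longleftrightarrow> (\<forall>s\<in>S. \<not> hitting_set C (S - {s}))"
    (is "?L \<longleftrightarrow> ?R")
  proof
    assume R: ?R
    show ?L
    proof (intro allI impI)
      fix S' assume "S' \<subset> S"
      then obtain s where "s \<in> S" "S' \<subseteq> S - {s}" by blast
      with R hitting_set_mono show "\<not> hitting_set C S'" by blast
    qed
  qed blast
  moreover have "\<not> hitting_set C (S - {s}) \<longleftrightarrow> (\<exists>U\<in>C. S \<inter> U = {s})"
    if "hitting_set C S" "s \<in> S" for s
    using that unfolding hitting_set_def by blast
  ultimately show ?thesis
    unfolding minimal_hitting_set_def by blast
qed

text \<open>Members of \<open>C\<close> act as circuits of a matroid, minimal hitting sets as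
  complements of its bases. The element to give up is any \<open>s\<close> whose fundamental circuit
  contains \<open>r\<close>; minimality of \<open>R\<close> puts \<open>r\<close> on some circuit,
  which forces such an \<open>s\<close> to exist.\<close>

lemma minimal_hitting_set_exchange:
  assumes antichain: "\<And>U U'. U \<in> C \<Longrightarrow> U' \<in> C \<Longrightarrow> U \<subseteq> U' \<Longrightarrow> U = U'"
    and elim: "\<And>U U' x r. U \<in> C \<Longrightarrow> U' \<in> C \<Longrightarrow> x \<in> U \<inter> U' \<Longrightarrow> r \<in> U - U' \<Longrightarrow>
      \<exists>D\<in>C. r \<in> D \<and> D \<subseteq> U \<union> U' - {x}"
    and "finite S" and S: "minimal_hitting_set C S"
    and R: "minimal_hitting_set C R" and "r \<in> R"
  shows "\<exists>s\<in>S. minimal_hitting_set C (S - {s} \<union> {r})"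
proof (cases "r \<in> S")
  case True
  then show ?thesis
    using S by (metis Un_insert_right insert_Diff sup_bot_right)
next
  case False
  have hit: "S \<inter> U \<noteq> {}" if "U \<in> C" for U
    using S that by (auto simp: minimal_hitting_set_def hitting_set_def)
  \<comment> \<open>The antichain property supplies the point of \<open>U - U'\<close> that
    \<open>elim\<close> asks for.\<close>
  have weak_elim: "\<exists>D\<in>C. D \<subseteq> U \<union> U' - {x}" if "U \<in> C" "U' \<in> C" "U \<noteq> U'" "x \<in> U \<inter> U'" for U U' x
  proof -
    from antichain that obtain y where "y \<in> U - U'" by blast
    with elim that show ?thesis by meson
  qed
  \<comment> \<open>\<open>F s\<close> is the fundamental circuit of \<open>s\<close> relative to
    the complement of \<open>S\<close>.\<close>
  obtain F where F: "\<And>s. s \<in> S \<Longrightarrow> F s \<in> C" "\<And>s. s \<in> S \<Longrightarrow> S \<inter> F s = {s}"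
    using S unfolding minimal_hitting_set_iff by metis
  \<comment> \<open>Eliminating \<open>s\<close> between two such circuits would leave a circuit
    missing \<open>S\<close>.\<close>
  have F_unique: "U = F s" if U: "U \<in> C" "S \<inter> U = {s}" for U s
  proof (rule ccontr)
    assume "U \<noteq> F s"
    have s: "s \<in> U" "s \<in> S" using U(2) by auto
    then have "s \<in> F s" using F(2) by blast
    with s obtain D where D: "D \<in> C" "D \<subseteq> U \<union> F s - {s}"
      using weak_elim[OF U(1) F(1) \<open>U \<noteq> F s\<close>] by blast
    from D(2) U(2) F(2)[OF s(2)] have "S \<inter> D = {}" by blast
    with hit[OF D(1)] show False by blast
  qed
  have "\<exists>s\<in>S. r \<in> F s"
  proof (rule ccontr)
    assume no: "\<not> ?thesis"
    \<comment> \<open>Induction on the number of points of \<open>S\<close> in \<open>U\<close>: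
      eliminating \<open>s\<close> against \<open>F s\<close> keeps \<open>r\<close>, removes
      \<open>s\<close>, and brings in no new point of \<open>S\<close>.\<close>
    have "r \<notin> U" if "U \<in> C" for U
      using that
    proof (induction "card (S \<inter> U)" arbitrary: U rule: less_induct)
      case less
      show ?case
      proof
        assume "r \<in> U"
        obtain s where s: "s \<in> S" "s \<in> U" using hit less.prems by blast
        then obtain D where D: "D \<in> C" "r \<in> D" "D \<subseteq> U \<union> F s - {s}"
          using elim[OF less.prems F(1), of s s r] F(2)[of s] no \<open>r \<in> U\<close> by blast
        then have "S \<inter> D \<subset> S \<inter> U" using F[OF s(1)] s by blast
        then have "card (S \<inter> D) < card (S \<inter> U)"
          using \<open>finite S\<close> by (intro psubset_card_mono) auto
        with less.hyps D show False by blast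
      qed
    qed
    moreover obtain U where "U \<in> C" "R \<inter> U = {r}"
      using R \<open>r \<in> R\<close> unfolding minimal_hitting_set_iff by blast
    ultimately show False by blast
  qed
  then obtain s where s: "s \<in> S" "r \<in> F s" by blast
  let ?S = "S - {s} \<union> {r}"
  \<comment> \<open>A circuit missed by the new set meets \<open>S\<close> only in \<open>s\<close>,
    so it is \<open>F s\<close>, which contains \<open>r\<close>.\<close>
  have hit': "?S \<inter> U \<noteq> {}" if "U \<in> C" for U
  proof
    assume e: "?S \<inter> U = {}"
    then have "S \<inter> U = {s}" using hit[OF that] by blast
    with F_unique[OF that] s e show False by blast
  qed
  have "\<exists>U\<in>C. ?S \<inter> U = {t}" if t: "t \<in> ?S" for t
  proof (cases "t = r")
    case True
    then show ?thesis using F(1)[OF s(1)] F(2)[OF s(1)] s by (intro bexI[of _ "F s"]) auto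
  next
    case False
    with t have t: "t \<in> S" "t \<noteq> s" by auto
    show ?thesis
    \<comment> \<open>If \<open>F t\<close> contains \<open>r\<close>, eliminating \<open>r\<close>
      against \<open>F s\<close> gives a circuit on which \<open>t\<close> is the only possible
      point of the new set; otherwise \<open>F t\<close> itself serves.\<close>
    proof (cases "r \<in> F t")
      case True
      have "F t \<noteq> F s" using F(2)[OF s(1)] F(2)[OF t(1)] t by blast
      then obtain D where D: "D \<in> C" "D \<subseteq> F t \<union> F s - {r}"
        using weak_elim[OF F(1)[OF t(1)] F(1)[OF s(1)], of r] s True by blast
      then have "?S \<inter> D \<subseteq> {t}" using F(2)[OF t(1)] F(2)[OF s(1)] by blast
      with hit'[OF D(1)] D(1) show ?thesis by blast
    next
      case False
      then show ?thesis using F[OF t(1)] t by (intro bexI[of _ "F t"]) auto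
    qed
  qed
  then have "minimal_hitting_set C ?S"
    unfolding minimal_hitting_set_iff hitting_set_def using hit' by blast
  with s show ?thesis by blast
qed

section \<open>Branches of a tree\<close>

text \<open>Acyclicity is expressed by \<open>separated\<close>: distinct neighbours of a vertex \<open>v\<close> lie in
  distinct components after deleting \<open>v\<close>.\<close>

locale tree_relation =
  fixes V :: "'a set" and E :: "'a rel"
  assumes finite_V: "finite V"
    and E_sub: "E \<subseteq> V \<times> V"
    and sym_E: "sym E"
    and connected: "x \<in> V \<Longrightarrow> y \<in> V \<Longrightarrow> (x, y) \<in> rtrancl_on V E"
    and separated: "(v, b) \<in> E \<Longrightarrow> (v, b') \<in> E \<Longrightarrow> (b, b') \<in> rtrancl_on (V - {v}) E \<Longrightarrow> b = b'"
begin

text \<open>The component of \<open>z\<close> after deleting \<open>v\<close>; empty unless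
  \<open>z\<close> lies in \<open>V - {v}\<close>, as \<open>rtrancl_on\<close> is reflexive only on
  its carrier.\<close>

definition branch :: "'a \<Rightarrow> 'a \<Rightarrow> 'a set" where
  "branch v z = {y. (z, y) \<in> rtrancl_on (V - {v}) E}"

lemma branch_subset: "branch v z \<subseteq> V - {v}"
  unfolding branch_def by (auto dest: in_rtrancl_on_in_F)

lemma self_in_branch: "z \<in> V \<Longrightarrow> z \<noteq> v \<Longrightarrow> z \<in> branch v z"
  unfolding branch_def by auto

lemma branch_eqI:
  assumes "y \<in> branch v z" shows "branch v y = branch v z"
proof -
  have "(z, y) \<in> rtrancl_on (V - {v}) E" "(y, z) \<in> rtrancl_on (V - {v}) E"
    using assms rtrancl_on_sym[OF sym_E] by (auto simp: branch_def sym_def)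
  then show ?thesis by (auto simp: branch_def intro: rtrancl_on_trans)
qed

lemma branches_eq_or_disjoint: "branch v y = branch v z \<or> branch v y \<inter> branch v z = {}"
  using branch_eqI by blast

lemma branch_step: "y \<in> branch v z \<Longrightarrow> (y, y') \<in> E \<Longrightarrow> y' \<noteq> v \<Longrightarrow> y' \<in> branch v z"
  unfolding branch_def using E_sub by (auto intro: rtrancl_on_into_rtrancl_on)

lemma branch_neighbour_unique:
  "(v, b) \<in> E \<Longrightarrow> (v, b') \<in> E \<Longrightarrow> b' \<in> branch v b \<Longrightarrow> b' = b"
  using separated unfolding branch_def by blast

lemma branches_disjoint:
  assumes "(v, b) \<in> E" "(v, b') \<in> E" "b \<noteq> b'"
  shows "branch v b \<inter> branch v b' = {}"
proof (rule ccontr)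
  assume ne: "branch v b \<inter> branch v b' \<noteq> {}"
  then have "branch v b = branch v b'" using branches_eq_or_disjoint by blast
  moreover have "b' \<in> branch v b'"
    using ne by (auto simp: branch_def dest: in_rtrancl_on_in_F)
  ultimately show False using branch_neighbour_unique assms by blast
qed

lemma in_branch_neighbour:
  assumes "z \<in> V" "v \<in> V" "z \<noteq> v"
  obtains b where "(v, b) \<in> E" "z \<in> branch v b"
proof -
  \<comment> \<open>The walk from \<open>v\<close> may return to \<open>v\<close>, hence the first
    disjunct; leaving \<open>v\<close> again enters the branch of the new neighbour.\<close>
  have "z = v \<or> (\<exists>b. (v, b) \<in> E \<and> z \<in> branch v b)"
    using connected[OF \<open>v \<in> V\<close> \<open>z \<in> V\<close>]
  proof (induct rule: rtrancl_on_induct)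
    case (step y z)
    then show ?case
      using branch_step self_in_branch by metis
  qed simp
  with that assms show ?thesis by blast
qed

text \<open>The branch together with \<open>v\<close> is connected and avoids \<open>w\<close>, so
  it stays in one component when \<open>w\<close> is deleted.\<close>

lemma branch_subset_branch:
  assumes vb: "(v, b) \<in> E" and w: "w \<notin> branch v b" "w \<noteq> v"
  shows "insert v (branch v b) \<subseteq> branch w v"
proof -
  have v: "v \<in> branch w v" using vb w E_sub by (intro self_in_branch) auto
  have "y \<in> branch w v" if "y \<in> branch v b" for y
  proof -
    from that have "(b, y) \<in> rtrancl_on (V - {v}) E" by (simp add: branch_def)
    then show ?thesis
    proof (induct rule: rtrancl_on_induct)
      case base
      then have "b \<in> branch v b" by (intro self_in_branch) auto
      with v vb w show ?case by (blast intro: branch_step)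
    next
      case (step y z)
      have "z \<in> branch v b"
        using step by (auto simp: branch_def intro: rtrancl_on_into_rtrancl_on)
      with step w show ?case by (blast intro: branch_step)
    qed
  qed
  with v show ?thesis by blast
qed

text \<open>The complement consists of \<open>v\<close> and the other branches at \<open>v\<close>.
  None of these contains \<open>w\<close>, so \<open>branch_subset_branch\<close> applies to
  each.\<close>

lemma complement_branch_subset:
  assumes vb: "(v, b) \<in> E" and w: "w \<in> branch v b"
  shows "V - branch v b \<subseteq> branch w v"
proof
  fix z assume z: "z \<in> V - branch v b"
  have "v \<in> V" "w \<noteq> v" using vb E_sub w branch_subset by auto
  show "z \<in> branch w v"
  proof (cases "z = v")
    case True
    with \<open>v \<in> V\<close> \<open>w \<noteq> v\<close> show ?thesis using self_in_branch by auto
  next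
    case False
    with z \<open>v \<in> V\<close> obtain c where c: "(v, c) \<in> E" "z \<in> branch v c"
      using in_branch_neighbour by blast
    with z w have "w \<notin> branch v c" using branches_eq_or_disjoint by blast
    with branch_subset_branch c \<open>w \<noteq> v\<close> show ?thesis by blast
  qed
qed

text \<open>If \<open>w\<close> lies in the branch \<open>A\<close> at \<open>v\<close>, then the branch at \<open>w\<close> containing \<open>v\<close> is larger than
  \<open>A\<close> while all others are smaller; so neither of two branches at \<open>w\<close> of equal size contains \<open>v\<close>.\<close>

lemma paired_branches_nested:
  assumes A: "(v, a) \<in> E" "(v, a') \<in> E" "a \<noteq> a'" "card (branch v a) = card (branch v a')"
    and B: "(w, b) \<in> E" "(w, b') \<in> E" "b \<noteq> b'" "card (branch w b) = card (branch w b')"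
    and x: "x \<in> branch w b" "x \<in> branch v a \<union> branch v a'"
    and y: "y \<in> branch w b'" "y \<in> branch v a \<union> branch v a'"
  shows "branch w b \<union> branch w b' \<subseteq> branch v a \<union> branch v a'"
proof -
  have BB: "branch w b \<inter> branch w b' = {}" using branches_disjoint B by blast
  have fin: "finite (branch u c)" for u c
    using branch_subset finite_V by (metis finite_Diff finite_subset)
  have inside: "branch w b \<union> branch w b' \<subseteq> branch v c"
    if c: "(v, c) \<in> E" "branch v c \<inter> branch v c' = {}" "card (branch v c) = card (branch v c')"
      and w: "w \<in> branch v c" for c c'
  proof -
    have large: "V - branch v c \<subseteq> branch w v"
      using complement_branch_subset c w by blast
    moreover have "insert v (branch v c') \<subseteq> V - branch v c"
      using c branch_subset E_sub by blast
    \<comment> \<open>The complement of \<open>branch v c\<close> holds the equally large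
      \<open>branch v c'\<close> and also \<open>v\<close>, which makes the comparison
      strict.\<close>
    ultimately have "card (insert v (branch v c')) \<le> card (branch w v)"
      using fin by (meson card_mono order_trans)
    moreover have "v \<notin> branch v c'" using branch_subset by blast
    ultimately have less: "card (branch v c) < card (branch w v)"
      using fin c by simp
    have small: "branch w d \<subset> branch v c" if "branch w d \<noteq> branch w v" for d
      using that large w branches_eq_or_disjoint[of w d v] branch_subset[of w d] by blast
    have ne: "branch w d \<noteq> branch w v"
      if "card (branch w d) = card (branch w d')" "branch w d \<noteq> branch w d'" for d d'
    proof
      assume d: "branch w d = branch w v"
      with that have "card (branch w d') < card (branch v c)"
        using small[of d'] fin psubset_card_mono by metis
      with less d that show False by simp
    qed
    have "branch w b \<noteq> branch w b'" using BB x by blast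
    then show ?thesis using ne[of b b'] ne[of b' b] small B by (metis Un_least psubset_imp_subset)
  qed
  have AA: "branch v a \<inter> branch v a' = {}" using branches_disjoint A by blast
  consider "w = v" | "w \<in> branch v a" | "w \<in> branch v a'"
    | "w \<noteq> v" "w \<notin> branch v a" "w \<notin> branch v a'" by blast
  then show ?thesis
  proof cases
    case 1
    then show ?thesis using x y branches_eq_or_disjoint by blast
  next
    case 2
    then show ?thesis using inside[of a a'] A AA by blast
  next
    case 3
    then show ?thesis using inside[of a' a] A AA by (metis Int_commute le_supI2)
  next
    case 4
    \<comment> \<open>Seen from \<open>w\<close>, both branches at \<open>v\<close> lie in a single
      branch, whereas \<open>x\<close> and \<open>y\<close> lie in different ones.\<close>
    then have "x \<in> branch w v" "y \<in> branch w v"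
      using branch_subset_branch A x y by blast+
    then have False using x y BB branches_eq_or_disjoint by blast
    then show ?thesis ..
  qed
qed

section \<open>Minimal supports of automorphisms\<close>

text \<open>Quantifying over all \<open>u\<close>, \<open>u'\<close> is the same as over vertices,
  because \<open>E\<close> lies in \<open>V \<times> V\<close> and \<open>g\<close> permutes
  \<open>V\<close>.\<close>

definition auts :: "('a \<Rightarrow> 'a) set" where
  "auts = {g. g permutes V \<and> (\<forall>u u'. (g u, g u') \<in> E \<longleftrightarrow> (u, u') \<in> E)}"

lemma auts_bij: "g \<in> auts \<Longrightarrow> bij g"
  unfolding auts_def by (auto intro: permutes_bij)

lemma auts_inv_simps:
  assumes "g \<in> auts" shows "g (inv g x) = x" "inv g (g x) = x"
  using assms unfolding auts_def by (auto simp: permutes_inverses)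

lemma auts_inv: "g \<in> auts \<Longrightarrow> inv g \<in> auts"
  using auts_inv_simps(1)[of g] unfolding auts_def by (auto intro: permutes_inv) metis+

lemma auts_comp: "g \<in> auts \<Longrightarrow> h \<in> auts \<Longrightarrow> g \<circ> h \<in> auts"
  unfolding auts_def by (auto intro: permutes_compose)

lemma auts_in_V: "g \<in> auts \<Longrightarrow> g x \<in> V \<longleftrightarrow> x \<in> V"
  unfolding auts_def by (auto simp: permutes_in_image)

definition supp :: "('a \<Rightarrow> 'a) \<Rightarrow> 'a set" where
  "supp g = {x. g x \<noteq> x}"

lemma supp_subset: "g \<in> auts \<Longrightarrow> supp g \<subseteq> V"
  unfolding auts_def supp_def by (auto simp: permutes_def)

lemma supp_empty_iff: "supp g = {} \<longleftrightarrow> g = id"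
  by (auto simp: supp_def)

lemma supp_inv: "g \<in> auts \<Longrightarrow> supp (inv g) = supp g"
  unfolding supp_def using auts_inv_simps by metis

lemma image_in_supp_iff: "g \<in> auts \<Longrightarrow> g x \<in> supp g \<longleftrightarrow> x \<in> supp g"
  by (simp add: supp_def inj_eq[OF bij_is_inj[OF auts_bij]])

lemma supp_conj: "h \<in> auts \<Longrightarrow> supp (h \<circ> g \<circ> inv h) = h ` supp g"
  by (auto simp: supp_def auts_inv_simps image_iff inj_eq[OF bij_is_inj[OF auts_bij]])
    (metis auts_inv_simps(1))

section \<open>Automorphisms acting on branches\<close>

lemma image_branch_subset:
  assumes g: "g \<in> auts" shows "g ` branch v z \<subseteq> branch (g v) (g z)"
proof
  fix y assume "y \<in> g ` branch v z"
  then obtain x where x: "y = g x" "(z, x) \<in> rtrancl_on (V - {v}) E"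
    by (auto simp: branch_def)
  have gV: "u \<in> V - {v} \<Longrightarrow> g u \<in> V - {g v}" for u
    using g auts_in_V auts_inv_simps(2)[OF g] by (metis Diff_iff singleton_iff)
  from x(2) have "(g z, g x) \<in> rtrancl_on (V - {g v}) E"
  proof (induct rule: rtrancl_on_induct)
    case (step u u')
    moreover have "(g u, g u') \<in> E" using g step by (simp add: auts_def)
    ultimately show ?case using gV by (blast intro: rtrancl_on_into_rtrancl_on)
  qed (use gV in auto)
  with x show "y \<in> branch (g v) (g z)" by (simp add: branch_def)
qed

lemma image_branch:
  assumes g: "g \<in> auts" shows "g ` branch v z = branch (g v) (g z)"
proof
  show "branch (g v) (g z) \<subseteq> g ` branch v z"
    using image_branch_subset[OF auts_inv[OF g], of "g v" "g z"]
    by (force simp: auts_inv_simps[OF g] image_iff subset_iff)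
qed (rule image_branch_subset[OF g])

text \<open>Restrict the motion of \<open>g\<close> to two branches. The only edges leaving them
  join \<open>b\<close> and \<open>g b\<close> to \<open>v\<close>; the swap exchanges these two
  edges.\<close>

lemma branch_swap:
  assumes g: "g \<in> auts" "g v = v" and b: "(v, b) \<in> E" "g b \<noteq> b"
  shows "\<exists>s\<in>auts. supp s = branch v b \<union> branch v (g b)"
proof -
  define A where "A = branch v b"
  define A' where "A' = branch v (g b)"
  \<comment> \<open>On \<open>A'\<close> the inverse is used because \<open>g\<close> may send
    \<open>A'\<close> to a third branch; this makes \<open>s\<close> an involution.\<close>
  define s where "s x = (if x \<in> A then g x else if x \<in> A' then inv g x else x)" for x
  have b': "(v, g b) \<in> E" using g b unfolding auts_def by (metis (mono_tags, lifting) mem_Collect_eq)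
  have "g ` A = A'" unfolding A_def A'_def using image_branch[OF g(1)] g by simp
  then have gA: "x \<in> A \<Longrightarrow> g x \<in> A'" "y \<in> A' \<Longrightarrow> inv g y \<in> A" for x y
    using auts_inv_simps[OF g(1)] by (auto simp: image_iff)
  have disj: "A \<inter> A' = {}" unfolding A_def A'_def using branches_disjoint b b' by metis
  have sub: "A \<subseteq> V - {v}" "A' \<subseteq> V - {v}"
    unfolding A_def A'_def using branch_subset by auto
  have ss: "s (s x) = x" for x
    using disj gA[of x] auts_inv_simps[OF g(1)] by (auto simp: s_def)
  have sV: "x \<notin> V \<Longrightarrow> s x = x" for x using sub by (auto simp: s_def)
  have perm: "s permutes V" unfolding permutes_def using ss sV by metis
  have leave: "x = b \<and> y = v" if "(x, y) \<in> E" "x \<in> A" "y \<notin> A" for x y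
  proof -
    from that have "y = v" unfolding A_def using branch_step by blast
    with that show ?thesis using branch_neighbour_unique[OF b(1)] sym_E
      by (auto simp: sym_def A_def)
  qed
  have leave': "x = g b \<and> y = v" if "(x, y) \<in> E" "x \<in> A'" "y \<notin> A'" for x y
  proof -
    from that have "y = v" unfolding A'_def using branch_step by blast
    with that show ?thesis using branch_neighbour_unique[OF b'(1)] sym_E
      by (auto simp: sym_def A'_def)
  qed
  have symE: "(x, y) \<in> E \<longleftrightarrow> (y, x) \<in> E" for x y using sym_E by (auto simp: sym_def)
  have gE: "(x, y) \<in> E \<Longrightarrow> (g x, g y) \<in> E" "(x, y) \<in> E \<Longrightarrow> (inv g x, inv g y) \<in> E" for x y
    using g auts_inv[OF g(1)] unfolding auts_def by auto
  have vA: "v \<notin> A" "v \<notin> A'" using sub by auto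
  have out: "(s x, s y) \<in> E" if xy: "(x, y) \<in> E" and "x \<in> A \<union> A'" for x y
  proof (cases "x \<in> A")
    case True
    show ?thesis
    proof (cases "y \<in> A")
      case False
      with leave xy True have "x = b" "y = v" by auto
      then show ?thesis using True vA b' symE[of "g b" v] by (simp add: s_def)
    qed (use True gE(1)[OF xy] in \<open>simp add: s_def\<close>)
  next
    case False
    then have x: "x \<in> A'" using that by blast
    show ?thesis
    proof (cases "y \<in> A'")
      case True
      then have "y \<notin> A" using disj by blast
      then show ?thesis using True x \<open>x \<notin> A\<close> gE(2)[OF xy] by (simp add: s_def)
    next
      case False
      with leave' xy x have "x = g b" "y = v" by auto
      then show ?thesis
        using x \<open>x \<notin> A\<close> vA b symE[of b v] auts_inv_simps[OF g(1)] by (simp add: s_def)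
    qed
  qed
  have fwd: "(s x, s y) \<in> E" if "(x, y) \<in> E" for x y
  proof (cases "x \<in> A \<union> A' \<or> y \<in> A \<union> A'")
    case True
    then show ?thesis using out that symE by blast
  next
    case False
    then show ?thesis using that by (simp add: s_def)
  qed
  \<comment> \<open>For an involution, preserving edges forwards already gives the
    equivalence.\<close>
  have "(s x, s y) \<in> E \<longleftrightarrow> (x, y) \<in> E" for x y
    using fwd[of x y] fwd[of "s x" "s y"] ss by auto
  with perm have "s \<in> auts" by (simp add: auts_def)
  moreover have "supp s = A \<union> A'"
  proof -
    have "s x \<noteq> x" if "x \<in> A \<union> A'" for x
      using that disj gA[of x] by (auto simp: s_def)
    moreover have "s x = x" if "x \<notin> A \<union> A'" for x
      using that by (simp add: s_def)
    ultimately show ?thesis unfolding supp_def by blast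
  qed
  ultimately show ?thesis unfolding A_def A'_def by blast
qed

section \<open>The circuits: minimal supports of nontrivial automorphisms\<close>

definition minimal_supports :: "'a set set" where
  "minimal_supports = {supp g |g. g \<in> auts \<and> g \<noteq> id \<and>
     (\<forall>h\<in>auts. h \<noteq> id \<longrightarrow> supp h \<subseteq> supp g \<longrightarrow> supp h = supp g)}"

lemma minimal_supports_least:
  "U \<in> minimal_supports \<Longrightarrow> h \<in> auts \<Longrightarrow> h \<noteq> id \<Longrightarrow> supp h \<subseteq> U \<Longrightarrow> supp h = U"
  unfolding minimal_supports_def by blast

lemma minimal_supports_nonid: "supp g \<in> minimal_supports \<Longrightarrow> g \<noteq> id"
  unfolding minimal_supports_def by (auto simp: supp_def fun_eq_iff)

lemma minimal_supportsE:
  assumes "U \<in> minimal_supports"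
  obtains g where "g \<in> auts" "g \<noteq> id" "supp g = U"
  using assms unfolding minimal_supports_def by blast

lemma minimal_supports_antichain:
  "U \<in> minimal_supports \<Longrightarrow> U' \<in> minimal_supports \<Longrightarrow> U \<subseteq> U' \<Longrightarrow> U = U'"
  by (metis minimal_supportsE minimal_supports_least)

text \<open>Supports are finite, so passing to strictly smaller nonempty ones terminates.\<close>

lemma minimal_supports_below:
  assumes "g \<in> auts" "g \<noteq> id"
  shows "\<exists>U\<in>minimal_supports. U \<subseteq> supp g"
  using assms
proof (induction "card (supp g)" arbitrary: g rule: less_induct)
  case less
  show ?case
  proof (cases "\<exists>h\<in>auts. h \<noteq> id \<and> supp h \<subset> supp g")
    case True
    then obtain h where h: "h \<in> auts" "h \<noteq> id" "supp h \<subset> supp g" by blast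
    moreover have "finite (supp g)"
      using less.prems supp_subset finite_V finite_subset by blast
    ultimately have "card (supp h) < card (supp g)" by (intro psubset_card_mono)
    with less.hyps[OF this h(1,2)] h(3) show ?thesis by blast
  next
    case False
    then have "supp g \<in> minimal_supports"
      unfolding minimal_supports_def using less.prems by blast
    then show ?thesis by blast
  qed
qed

text \<open>The swap built by \<open>branch_swap\<close> has nonempty support inside
  \<open>supp g\<close>, so by minimality it has the same support. Hence \<open>g\<close> itself
  must exchange the two branches.\<close>

lemma minimal_support_branches:
  assumes g: "g \<in> auts" "supp g \<in> minimal_supports" "supp g \<noteq> V"
  obtains v b where "(v, b) \<in> E" "(v, g b) \<in> E" "b \<noteq> g b"
    "supp g = branch v b \<union> branch v (g b)"
    "g ` branch v b = branch v (g b)" "g ` branch v (g b) = branch v b"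
    "card (branch v b) = card (branch v (g b))"
proof -
  obtain u where u: "u \<in> V" "g u = u"
    using g supp_subset[OF g(1)] by (auto simp: supp_def)
  obtain z where z: "z \<in> V" "g z \<noteq> z"
    using g minimal_supports_nonid supp_empty_iff supp_subset[OF g(1)] by (auto simp: supp_def fun_eq_iff)
  \<comment> \<open>A walk from the fixed vertex \<open>u\<close> to the moved vertex
    \<open>z\<close> has an edge from a fixed vertex to a moved one.\<close>
  have "\<exists>v b. (v, b) \<in> E \<and> g v = v \<and> g b \<noteq> b"
  proof (rule ccontr)
    assume no: "\<not> ?thesis"
    from connected[OF u(1) z(1)] have "g z = z"
      by (induct rule: rtrancl_on_induct) (use no u in auto)
    with z show False by blast
  qed
  then obtain v b where b: "(v, b) \<in> E" "g v = v" "g b \<noteq> b" by blast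
  have b': "(v, g b) \<in> E" using g b unfolding auts_def by (metis (mono_tags, lifting) mem_Collect_eq)
  obtain s where s: "s \<in> auts" "supp s = branch v b \<union> branch v (g b)"
    using branch_swap g b by blast
  have img: "g ` branch v b = branch v (g b)"
    using image_branch[OF g(1), of v b] b by simp
  have "g b \<in> V" "b \<in> V" "b \<noteq> v" "g b \<noteq> v"
    using b b' E_sub auts_inv_simps(2)[OF g(1)] by auto metis+
  then have bb: "b \<in> branch v b" "g b \<in> branch v (g b)"
    using self_in_branch by auto
  have disj: "branch v b \<inter> branch v (g b) = {}" using branches_disjoint b b' by metis
  have "branch v b \<subseteq> supp g"
  proof
    fix x assume x: "x \<in> branch v b"
    with img have "g x \<in> branch v (g b)" by blast
    with x disj have "g x \<noteq> x" by auto
    then show "x \<in> supp g" by (simp add: supp_def)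
  qed
  moreover from this have "branch v (g b) \<subseteq> supp g"
    unfolding img[symmetric] using image_in_supp_iff[OF g(1)] by auto
  moreover have "supp s \<noteq> {}" using s(2) bb(1) by blast
  then have "s \<noteq> id" by (simp add: supp_empty_iff)
  ultimately have U: "supp g = branch v b \<union> branch v (g b)"
    using minimal_supports_least[OF g(2) s(1)] s(2) by simp
  have inj: "inj g" using auts_bij g bij_is_inj by blast
  have "g ` supp g = supp g"
  proof -
    have "x \<in> g ` supp g" if "x \<in> supp g" for x
      using that image_in_supp_iff[OF g(1), of "inv g x"] auts_inv_simps(1)[OF g(1), of x]
      by (metis imageI)
    then show ?thesis using image_in_supp_iff[OF g(1)] by auto
  qed
  \<comment> \<open>As \<open>g\<close> permutes its support injectively and sends the first branch
    onto the second, it must send the second onto the first.\<close>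
  then have "branch v (g b) \<union> g ` branch v (g b) = branch v b \<union> branch v (g b)"
    using U img by (simp add: image_Un)
  moreover have "branch v (g b) \<inter> g ` branch v (g b) = {}"
    using img disj image_Int[OF inj, of "branch v b" "branch v (g b)"] by auto
  ultimately have "g ` branch v (g b) = branch v b" using disj by blast
  moreover have "card (branch v b) = card (branch v (g b))"
    using img inj by (metis card_image inj_on_subset subset_UNIV)
  ultimately show thesis using that[of v b] b b' U img by metis
qed

text \<open>\<open>x\<close> and \<open>h x\<close> lie in different branches of the pair forming
  \<open>supp h\<close>. Were both in \<open>supp g\<close>, \<open>paired_branches_nested\<close>
  would put \<open>supp h\<close> inside \<open>supp g\<close>, against the antichain
  property.\<close>

lemma minimal_supports_move_out:
  assumes g: "g \<in> auts" "supp g \<in> minimal_supports"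
    and h: "h \<in> auts" "supp h \<in> minimal_supports"
    and ne: "supp g \<noteq> supp h" and x: "x \<in> supp g" "x \<in> supp h"
  shows "h x \<notin> supp g"
proof
  assume hx: "h x \<in> supp g"
  have not_sub: "\<not> supp h \<subseteq> supp g" "\<not> supp g \<subseteq> supp h"
    using minimal_supports_antichain g h ne by blast+
  then have "supp g \<noteq> V" "supp h \<noteq> V" using supp_subset g h by blast+
  from minimal_support_branches[OF g this(1)] obtain v a where
    A: "(v, a) \<in> E" "(v, g a) \<in> E" "a \<noteq> g a" "card (branch v a) = card (branch v (g a))"
      "supp g = branch v a \<union> branch v (g a)" .
  from minimal_support_branches[OF h \<open>supp h \<noteq> V\<close>] obtain w b where
    B: "(w, b) \<in> E" "(w, h b) \<in> E" "b \<noteq> h b" "card (branch w b) = card (branch w (h b))"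
      "supp h = branch w b \<union> branch w (h b)"
      "h ` branch w b = branch w (h b)" "h ` branch w (h b) = branch w b" .
  from x B(5) consider "x \<in> branch w b" | "x \<in> branch w (h b)" by blast
  then have "supp h \<subseteq> supp g"
  proof cases
    case 1
    then have "h x \<in> branch w (h b)" using B(6) by blast
    with 1 paired_branches_nested[OF A(1-4) B(1-4)] x hx A(5) B(5) show ?thesis by blast
  next
    case 2
    then have "h x \<in> branch w b" using B(7) by blast
    with 2 paired_branches_nested[OF A(1-4) B(1-4)] x hx A(5) B(5) show ?thesis by blast
  qed
  with not_sub show False by blast
qed

lemma minimal_supports_elimination:
  assumes U: "U \<in> minimal_supports" "U' \<in> minimal_supports"
    and x: "x \<in> U \<inter> U'" and r: "r \<in> U - U'"
  shows "\<exists>D\<in>minimal_supports. r \<in> D \<and> D \<subseteq> U \<union> U' - {x}"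
proof -
  obtain g where g: "g \<in> auts" "g \<noteq> id" "supp g = U" using U minimal_supportsE by blast
  obtain h where h: "h \<in> auts" "h \<noteq> id" "supp h = U'" using U minimal_supportsE by blast
  note ih = auts_inv[OF h(1)]
  let ?k = "h \<circ> g \<circ> inv h"
  have k: "?k \<in> auts" using auts_comp g h ih by blast
  have sk: "supp ?k = h ` U" using supp_conj h g by blast
  \<comment> \<open>\<open>inv h\<close> has the same support as \<open>h\<close>, so the previous
    lemma applies to it; \<open>r\<close> witnesses that the two supports differ.\<close>
  have "inv h x \<notin> U"
    using minimal_supports_move_out[of g "inv h" x] g h ih U x r supp_inv[OF h(1)] by auto
  then have "x \<notin> h ` U" using auts_inv_simps[OF h(1)] by auto
  moreover have "h ` U \<subseteq> U \<union> U'"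
  proof -
    have "h y \<in> U \<union> U'" if "y \<in> U" for y
    proof (cases "y \<in> U'")
      case True
      then show ?thesis using image_in_supp_iff[OF h(1)] h(3) by blast
    next
      case False
      then have "h y = y" using h(3) by (auto simp: supp_def)
      with that show ?thesis by simp
    qed
    then show ?thesis by blast
  qed
  moreover have "h r = r" using r h by (auto simp: supp_def)
  then have "r \<in> h ` U" using r by (metis DiffD1 imageI)
  moreover have "h ` U \<in> minimal_supports"
  proof -
    have "supp l = h ` U" if l: "l \<in> auts" "l \<noteq> id" "supp l \<subseteq> h ` U" for l
    proof -
      \<comment> \<open>Conjugating back turns \<open>l\<close> into an automorphism supported
        inside \<open>U\<close>, so minimality of \<open>U\<close> transfers to its image under
        \<open>h\<close>.\<close>
      let ?m = "inv h \<circ> l \<circ> inv (inv h)"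
      have m: "?m \<in> auts" using auts_comp ih l auts_inv by blast
      have sm: "supp ?m = inv h ` supp l" using supp_conj ih by blast
      then have "supp ?m \<noteq> {}" using l supp_empty_iff by blast
      then have "?m \<noteq> id" using supp_empty_iff by blast
      moreover have "supp ?m \<subseteq> U" using sm l auts_inv_simps[OF h(1)] by auto
      ultimately have "inv h ` supp l = U" using minimal_supports_least[OF U(1) m] sm by simp
      then show ?thesis using auts_inv_simps[OF h(1)] by (auto simp: image_iff)
    qed
    moreover have "?k \<noteq> id" using sk \<open>r \<in> h ` U\<close> supp_empty_iff by blast
    ultimately show ?thesis
      unfolding minimal_supports_def mem_Collect_eq using k sk by (intro exI[of _ ?k]) simp
  qed
  ultimately show ?thesis by blast
qed

text \<open>\<open>g\<close> and \<open>h\<close> agree exactly off the support of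
  \<open>inv h \<circ> g\<close>, which contains a minimal support unless \<open>g = h\<close>.
  Conversely, a missed minimal support gives an automorphism agreeing with \<open>id\<close> on
  \<open>S\<close>.\<close>

lemma hitting_set_minimal_supports_iff:
  "hitting_set minimal_supports S \<longleftrightarrow>
     (\<forall>g\<in>auts. \<forall>h\<in>auts. (\<forall>s\<in>S. g s = h s) \<longrightarrow> g = h)" (is "?L \<longleftrightarrow> ?R")
proof
  assume L: ?L
  show ?R
  proof (intro ballI impI)
    fix g h assume gh: "g \<in> auts" "h \<in> auts" "\<forall>s\<in>S. g s = h s"
    have "inv h \<circ> g = id"
    proof (rule ccontr)
      assume "inv h \<circ> g \<noteq> id"
      then obtain U where "U \<in> minimal_supports" "U \<subseteq> supp (inv h \<circ> g)"
        using minimal_supports_below auts_comp auts_inv gh by metis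
      then have "S \<inter> supp (inv h \<circ> g) \<noteq> {}" using L by (auto simp: hitting_set_def)
      then show False using gh auts_inv_simps by (auto simp: supp_def)
    qed
    then show "g = h" using auts_inv_simps[OF gh(2)] by (metis comp_apply ext id_apply)
  qed
next
  assume R: ?R
  have id: "id \<in> auts" by (simp add: auts_def permutes_id)
  show ?L unfolding hitting_set_def
  proof (intro ballI notI)
    fix U assume U: "U \<in> minimal_supports" "S \<inter> U = {}"
    then obtain g where "g \<in> auts" "g \<noteq> id" "supp g = U" using minimal_supportsE by blast
    moreover from this U have "\<forall>s\<in>S. g s = id s" by (auto simp: supp_def)
    ultimately show False using R id by blast
  qed
qed

end

section \<open>Finite trees\<close>

text \<open>For \<open>separated\<close>: a path between distinct neighbours of \<open>v\<close>
  that avoids \<open>v\<close> closes up through \<open>v\<close> to a forbidden cycle.\<close>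

lemma finite_tree_imp_tree_relation:
  assumes "finite_tree T"
  shows "tree_relation (verts T) (arcs_ends T)"
proof -
  interpret graph T using assms by (simp add: finite_tree_def)
  have con: "strongly_connected T"
    using assms symmetric_connected_imp_strongly_connected sym_arcs by (simp add: finite_tree_def)
  show ?thesis
  proof
    show "finite (verts T)" by simp
    show "arcs_ends T \<subseteq> verts T \<times> verts T" by (auto simp: arcs_ends_conv)
    show "sym (arcs_ends T)" using sym_arcs by (simp add: symmetric_def)
    show "(x, y) \<in> rtrancl_on (verts T) (arcs_ends T)" if "x \<in> verts T" "y \<in> verts T" for x y
      using con that unfolding strongly_connected_def reachable_def by blast
  next
    fix v b b'
    assume vb: "(v, b) \<in> arcs_ends T" and vb': "(v, b') \<in> arcs_ends T"
      and bb': "(b, b') \<in> rtrancl_on (verts T - {v}) (arcs_ends T)"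
    show "b = b'"
    proof (rule ccontr)
      assume "b \<noteq> b'"
      from bb' have "\<exists>p. awalk b p b' \<and> v \<notin> set (awalk_verts b p)"
      proof (induct rule: converse_rtrancl_on_induct)
        case base
        then show ?case by (intro exI[of _ "[]"]) (auto simp: awalk_simps)
      next
        case (step x y)
        then obtain p where "awalk y p b'" "v \<notin> set (awalk_verts y p)" by blast
        moreover obtain e where "e \<in> arcs T" "tail T e = x" "head T e = y"
          using step by (auto simp: arcs_ends_conv)
        ultimately show ?case using step
          by (intro exI[of _ "e # p"]) (auto simp: awalk_simps)
      qed
      then obtain p0 where p0: "awalk b p0 b'" "v \<notin> set (awalk_verts b p0)" by blast
      \<comment> \<open>Shortening the walk to a path introduces no new vertices, so
        \<open>v\<close> is still avoided.\<close>
      define p where "p = awalk_to_apath p0"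
      have "apath b p b'" using p0 apath_awalk_to_apath by (simp add: p_def)
      moreover have "v \<notin> set (awalk_verts b p)"
        using p0(2) awalk_to_apath_subset[OF p0(1)] awalkI_apath[OF \<open>apath b p b'\<close>]
        unfolding p_def by (simp add: set_awalk_verts[OF p0(1)] set_awalk_verts) blast
      ultimately have p: "awalk b p b'" "distinct (awalk_verts b p)" "v \<notin> set (awalk_verts b p)"
        by (auto simp: apath_def)
      obtain e where e: "e \<in> arcs T" "tail T e = v" "head T e = b"
        using vb by (auto simp: arcs_ends_conv)
      obtain f where f: "f \<in> arcs T" "tail T f = b'" "head T f = v"
        using arcs_ends_symmetric[OF sym_arcs vb'] by (auto simp: arcs_ends_conv)
      \<comment> \<open>This is what gives the closed walk through \<open>v\<close> a third arc,
        ruling out a mere back-and-forth along one edge.\<close>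
      have "p \<noteq> []" using p \<open>b \<noteq> b'\<close> by (auto simp: awalk_simps)
      have w: "awalk b (p @ [f]) v" using p f by (auto simp: awalk_simps)
      have vs: "awalk_verts b (p @ [f]) = awalk_verts b p @ [v]"
        using w p f awalk_verts_append[OF w] by (auto simp: awalk_simps)
      have "cycle (e # p @ [f])"
        unfolding cycle_def
      proof (intro exI[of _ v] conjI)
        show "awalk v (e # p @ [f]) v" using w e by (auto simp: awalk_Cons_iff)
        show "distinct (tl (awalk_verts v (e # p @ [f])))" using e vs p by simp
      qed simp
      moreover have "3 \<le> length (e # p @ [f])" using \<open>p \<noteq> []\<close> by (cases p) auto
      ultimately show False using assms unfolding finite_tree_def by blast
    qed
  qed
qed

theorem theorem13:
  fixes T :: "('a, 'b) pre_digraph"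
  assumes "finite_tree T"
  shows "\<forall>S R. minimal_determining_set T S \<and> minimal_determining_set T R \<longrightarrow>
           (\<forall>r \<in> R. \<exists>s \<in> S. minimal_determining_set T ((S - {s}) \<union> {r}))"
proof -
  interpret t: tree_relation "verts T" "arcs_ends T"
    using assms by (rule finite_tree_imp_tree_relation)
  have Aut: "graph_Aut T = t.auts"
  proof -
    have "(\<forall>u\<in>verts T. \<forall>v\<in>verts T. (g u, g v) \<in> arcs_ends T \<longleftrightarrow> (u, v) \<in> arcs_ends T) \<longleftrightarrow>
        (\<forall>u v. (g u, g v) \<in> arcs_ends T \<longleftrightarrow> (u, v) \<in> arcs_ends T)" if "g permutes verts T" for g
      using t.E_sub permutes_in_image[OF that] by blast
    then show ?thesis unfolding graph_Aut_def t.auts_def by blast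
  qed
  have det: "determining_set T S \<longleftrightarrow> S \<subseteq> verts T \<and> hitting_set t.minimal_supports S" for S
    unfolding determining_set_def Aut t.hitting_set_minimal_supports_iff ..
  \<comment> \<open>Subsets of a vertex set are vertex sets, so both notions of minimality quantify
    over the same competitors.\<close>
  have mdet: "minimal_determining_set T S \<longleftrightarrow>
      S \<subseteq> verts T \<and> minimal_hitting_set t.minimal_supports S" for S
    unfolding minimal_determining_set_def minimal_hitting_set_def det by blast
  show ?thesis
  proof (intro allI impI ballI)
    fix S R r
    assume SR: "minimal_determining_set T S \<and> minimal_determining_set T R" and "r \<in> R"
    then have "finite S" using t.finite_V finite_subset by (auto simp: mdet)
    then obtain s where "s \<in> S" "minimal_hitting_set t.minimal_supports (S - {s} \<union> {r})"
      using minimal_hitting_set_exchange[OF t.minimal_supports_antichain t.minimal_supports_elimination]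
        SR \<open>r \<in> R\<close> unfolding mdet by blast
    moreover from this have "S - {s} \<union> {r} \<subseteq> verts T" using SR \<open>r \<in> R\<close> by (auto simp: mdet)
    ultimately show "\<exists>s\<in>S. minimal_determining_set T (S - {s} \<union> {r})" unfolding mdet by blast
  qed
qed

end
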